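(* Let $T\in\mathbb{B}(\mathcal{H})$ with $\ker T\subseteq\ker T^\ast$. If $s,t\in\mathcal{PQ}(T)$ are coprime, then $T$ is quasinormal.
   Context: $\mathbb{N}$ denotes the positive integers. $\mathbb{B}(\mathcal{H})$ is the algebra of bounded linear operators on a complex Hilbert space $\mathcal{H}$. Write $[S,T]=ST-TS$. $T$ is quasinormal if $[T,T^*T]=0$. The power-quasinormality index set of $T$ is $\mathcal{PQ}(T)=\{n\in\mathbb{N}:[T^n,T^\ast T]=0\}$. *)

theory Defs
  imports "HOL-Analysis.Analysis"
begin

section \<open>Complex Hilbert spaces\<close>

text \<open>
  \<open>HOL-Analysis\<close> has only real inner product spaces. A complex Hilbert space is modelled as a type
  class on top of the real normed spaces, so that boundedness, limits and completeness are the
  library's. The inner product is linear in its first argument. As for every type, the carrier is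
  nonempty; the zero space is allowed and no dimension or separability restriction is made.
\<close>

class complex_vector = real_vector +
  fixes scaleC :: "complex \<Rightarrow> 'a \<Rightarrow> 'a" (infixr "*\<^sub>C" 75)
  assumes scaleC_add_right: "c *\<^sub>C (x + y) = c *\<^sub>C x + c *\<^sub>C y"
    and scaleC_add_left: "(c + d) *\<^sub>C x = c *\<^sub>C x + d *\<^sub>C x"
    and scaleC_scaleC: "c *\<^sub>C d *\<^sub>C x = (c * d) *\<^sub>C x"
    and scaleC_one: "1 *\<^sub>C x = x"
    and scaleR_eq_scaleC: "r *\<^sub>R x = complex_of_real r *\<^sub>C x"

class complex_inner = complex_vector + real_normed_vector +
  fixes cinner :: "'a \<Rightarrow> 'a \<Rightarrow> complex"
  assumes cinner_commute: "cinner x y = cnj (cinner y x)"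
    and cinner_add_left: "cinner (x + y) z = cinner x z + cinner y z"
    and cinner_scaleC_left: "cinner (c *\<^sub>C x) y = c * cinner x y"
    and cinner_ge_zero: "0 \<le> Re (cinner x x)"
    and cinner_eq_zero_iff: "cinner x x = 0 \<longleftrightarrow> x = 0"
    and norm_eq_sqrt_cinner: "norm x = sqrt (Re (cinner x x))"

class chilbert_space = complex_inner + complete_space

instantiation complex :: chilbert_space
begin
definition scaleC_complex :: "complex \<Rightarrow> complex \<Rightarrow> complex" where "scaleC_complex c x = c * x"
definition cinner_complex :: "complex \<Rightarrow> complex \<Rightarrow> complex" where "cinner_complex x y = x * cnj y"
instance
proof
  fix x :: complex
  show "norm x = sqrt (Re (cinner x x))"
    by (simp add: cinner_complex_def cmod_def power2_eq_square)
qed (auto simp: scaleC_complex_def cinner_complex_def algebra_simps scaleR_conv_of_real)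
end

section \<open>Bounded operators and adjoints\<close>

definition bounded_clinear :: "('a::complex_inner \<Rightarrow> 'b::complex_inner) \<Rightarrow> bool" where
  "bounded_clinear T \<longleftrightarrow> bounded_linear T \<and> (\<forall>c x. T (c *\<^sub>C x) = c *\<^sub>C T x)"

text \<open>
  For a bounded operator on a Hilbert space the description below is proper, and its value is again
  a bounded operator; see \<open>cadjoint_works\<close> and \<open>bounded_clinear_cadjoint\<close>.
\<close>

definition cadjoint :: "('a::chilbert_space \<Rightarrow> 'a) \<Rightarrow> 'a \<Rightarrow> 'a" where
  "cadjoint T = (THE S. \<forall>x y. cinner (T x) y = cinner x (S y))"

lemma cinner_add_right: "cinner x (y + z) = cinner x y + cinner (x::'a::complex_inner) z"
  by (metis cinner_add_left cinner_commute complex_cnj_add)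

lemma cinner_scaleC_right: "cinner x (c *\<^sub>C y) = cnj c * cinner (x::'a::complex_inner) y"
  by (metis cinner_scaleC_left cinner_commute complex_cnj_mult)

lemma cinner_scaleR_left: "cinner (r *\<^sub>R x) y = of_real r * cinner (x::'a::complex_inner) y"
  by (simp add: scaleR_eq_scaleC cinner_scaleC_left)

lemma cinner_minus_right: "cinner x (- y) = - cinner (x::'a::complex_inner) y"
  by (metis add_eq_0_iff cinner_add_right add.right_neutral add_cancel_right_right
      add.right_inverse)

lemma cinner_diff_right: "cinner x (y - z) = cinner x y - cinner (x::'a::complex_inner) z"
  using cinner_add_right[of x y "- z"] by (simp add: cinner_minus_right)

lemma power2_norm_eq_cinner: "(norm (x::'a::complex_inner))\<^sup>2 = Re (cinner x x)"
  by (simp add: norm_eq_sqrt_cinner cinner_ge_zero)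

lemma Re_cinner_commute: "Re (cinner x y) = Re (cinner (y::'a::complex_inner) x)"
  by (subst cinner_commute) simp

lemma power2_norm_add:
  "(norm (x + y :: 'a::complex_inner))\<^sup>2 = (norm x)\<^sup>2 + (norm y)\<^sup>2 + 2 * Re (cinner x y)"
  by (simp add: power2_norm_eq_cinner cinner_add_left cinner_add_right Re_cinner_commute[of y x])

lemma parallelogram:
  "(norm (x + y :: 'a::complex_inner))\<^sup>2 + (norm (x - y))\<^sup>2 = 2 * (norm x)\<^sup>2 + 2 * (norm y)\<^sup>2"
  using power2_norm_add[of x y] power2_norm_add[of x "- y"] by (simp add: cinner_minus_right)

lemma Re_cinner_le: "Re (cinner x y) \<le> norm x * norm (y::'a::complex_inner)"
proof -
  have "(norm (x + y))\<^sup>2 \<le> (norm x + norm y)\<^sup>2"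
    by (intro power_mono norm_triangle_ineq) simp
  then show ?thesis
    unfolding power2_norm_add by (simp add: power2_sum)
qed

lemma abs_Re_cinner_le: "\<bar>Re (cinner x y)\<bar> \<le> norm x * norm (y::'a::complex_inner)"
  using Re_cinner_le[of x y] Re_cinner_le[of x "- y"] by (simp add: cinner_minus_right)

lemma cinner_ext:
  fixes y z :: "'a::complex_inner"
  assumes "\<And>x. cinner x y = cinner x z"
  shows "y = z"
proof -
  have "cinner (y - z) (y - z) = 0"
    using assms by (simp add: cinner_diff_right)
  then show ?thesis
    by (simp add: cinner_eq_zero_iff)
qed

lemma adjoint_vector_exists:
  fixes T :: "'a::chilbert_space \<Rightarrow> 'a"
  assumes "bounded_clinear T"
  shows "\<exists>z. \<forall>x. cinner (T x) y = cinner x z"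
proof -
  from assms have bl: "bounded_linear T" and sc: "\<And>c x. T (c *\<^sub>C x) = c *\<^sub>C T x"
    by (auto simp: bounded_clinear_def)
  interpret T: bounded_linear T by fact
  obtain K where K: "\<And>x. norm (T x) \<le> norm x * K"
    using T.bounded by blast
  define f where "f x = Re (cinner (T x) y)" for x
  have f_add: "f (u + v) = f u + f v" for u v
    by (simp add: f_def T.add cinner_add_left)
  have f_scale: "f (r *\<^sub>R u) = r * f u" for r u
    by (simp add: f_def T.scaleR cinner_scaleR_left)
  have f_bound: "\<bar>f u\<bar> \<le> norm u * (K * norm y)" for u
    using abs_Re_cinner_le[of "T u" y] mult_right_mono[OF K[of u] norm_ge_zero[of y]]
    by (simp add: f_def mult.assoc)
  have f_bl: "bounded_linear f"
    by (rule bounded_linear_intro[where K = "K * norm y"]) (use f_add f_scale f_bound in auto)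
  text \<open>The representing vector minimises \<open>J\<close>.\<close>
  define J where "J x = (norm x)\<^sup>2 - 2 * f x" for x
  have J_ge: "J x \<ge> - (K * norm y)\<^sup>2" for x
  proof -
    have "0 \<le> (norm x - K * norm y)\<^sup>2" by simp
    then show ?thesis
      using f_bound[of x] by (simp add: J_def power2_diff)
  qed
  define m where "m = (INF x. J x)"
  have bdd: "bdd_below (range J)"
    by (rule bdd_belowI[where m = "- (K * norm y)\<^sup>2"]) (use J_ge in auto)
  have m_le: "m \<le> J x" for x
    unfolding m_def by (rule cINF_lower[OF bdd]) simp
  have "\<exists>u. J u < m + inverse (real (Suc n))" for n
    using cINF_less_iff[OF _ bdd, of "m + inverse (real (Suc n))"] by (auto simp: m_def)
  then obtain u where u: "\<And>n. J (u n) < m + inverse (real (Suc n))"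
    by metis
  have dist: "(norm (a - b))\<^sup>2 \<le> 2 * (J a - m) + 2 * (J b - m)" for a b
  proof -
    have "4 * J ((1/2) *\<^sub>R (a + b)) = (norm (a + b))\<^sup>2 - 4 * (f a + f b)"
      unfolding J_def f_scale f_add norm_scaleR power_mult_distrib
      by (simp add: power2_eq_square field_simps)
    then have "(norm (a - b))\<^sup>2 = 2 * J a + 2 * J b - 4 * J ((1/2) *\<^sub>R (a + b))"
      using parallelogram[of a b] by (simp add: J_def)
    then show ?thesis
      using m_le[of "(1/2) *\<^sub>R (a + b)"] by simp
  qed
  have "Cauchy u"
  proof (rule metric_CauchyI)
    fix e :: real
    assume e: "e > 0"
    then obtain N where N: "inverse (real (Suc N)) < e\<^sup>2 / 4"
      using reals_Archimedean[of "e\<^sup>2 / 4"] by auto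
    have small: "J (u n) - m < e\<^sup>2 / 4" if "n \<ge> N" for n
    proof -
      have "inverse (real (Suc n)) \<le> inverse (real (Suc N))"
        using that by (intro le_imp_inverse_le) auto
      then show ?thesis using u[of n] N by linarith
    qed
    have "dist (u i) (u j) < e" if "i \<ge> N" "j \<ge> N" for i j
    proof -
      have "(norm (u i - u j))\<^sup>2 < e\<^sup>2"
        using dist[of "u i" "u j"] small[OF that(1)] small[OF that(2)] by (simp add: field_simps)
      then show ?thesis
        using e by (simp add: dist_norm power2_less_imp_less)
    qed
    then show "\<exists>M. \<forall>i\<ge>M. \<forall>j\<ge>M. dist (u i) (u j) < e"
      by blast
  qed
  then obtain z where z: "u \<longlonglongrightarrow> z"
    using Cauchy_convergent convergent_def by blast
  have "(\<lambda>n. J (u n)) \<longlonglongrightarrow> J z"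
    unfolding J_def by (intro tendsto_intros z bounded_linear.tendsto[OF f_bl])
  moreover have "(\<lambda>n. m + inverse (real (Suc n))) \<longlonglongrightarrow> m + 0"
    by (intro tendsto_intros LIMSEQ_inverse_real_of_nat)
  ultimately have Jz: "J z \<le> m"
    using LIMSEQ_le[of "\<lambda>n. J (u n)" "J z" "\<lambda>n. m + inverse (real (Suc n))" "m + 0"] u
    by (auto intro: less_imp_le)
  have re: "Re (cinner v z) = f v" for v
  proof -
    define d where "d = Re (cinner v z) - f v"
    have key: "0 \<le> t\<^sup>2 * (norm v)\<^sup>2 + 2 * t * d" for t
    proof -
      have "J (z + t *\<^sub>R v) = J z + t\<^sup>2 * (norm v)\<^sup>2 + 2 * t * d"
        unfolding J_def power2_norm_add f_add f_scale d_def
        by (simp add: Re_cinner_commute[of z] cinner_scaleR_left power_mult_distrib algebra_simps)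
      then show ?thesis using m_le[of "z + t *\<^sub>R v"] Jz by linarith
    qed
    have "d = 0"
    proof (rule ccontr)
      assume d: "d \<noteq> 0"
      define a where "a = (norm v)\<^sup>2 + 1"
      have a: "a > 0" "(norm v)\<^sup>2 \<le> a" unfolding a_def by (auto simp: add_nonneg_pos)
      have "0 \<le> (- d / a)\<^sup>2 * (norm v)\<^sup>2 + 2 * (- d / a) * d" by (rule key)
      also have "\<dots> \<le> (- d / a)\<^sup>2 * a + 2 * (- d / a) * d"
        using a by (intro add_right_mono mult_left_mono) auto
      also have "\<dots> = - (d\<^sup>2 / a)"
        using a by (simp add: field_simps power2_eq_square)
      also have "\<dots> < 0" using a d by simp
      finally show False by simp
    qed
    then show ?thesis by (simp add: d_def)
  qed
  have "cinner (T x) y = cinner x z" for x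
    using re[of x] re[of "\<i> *\<^sub>C x"]
    by (simp add: complex_eq_iff f_def sc cinner_scaleC_left)
  then show ?thesis by blast
qed

lemma cadjoint_works:
  assumes "bounded_clinear T"
  shows "cinner (T x) y = cinner x (cadjoint T y)"
proof -
  have "\<exists>!S. \<forall>x y. cinner (T x) y = cinner x (S y)"
  proof (rule ex_ex1I)
    show "\<exists>S. \<forall>x y. cinner (T x) y = cinner x (S y)"
      using adjoint_vector_exists[OF assms] by metis
    show "S = S'" if "\<forall>x y. cinner (T x) y = cinner x (S y)"
      "\<forall>x y. cinner (T x) y = cinner x (S' y)" for S S'
      using that by (metis cinner_ext ext)
  qed
  from theI'[OF this] show ?thesis
    unfolding cadjoint_def by blast
qed

lemma bounded_clinear_cadjoint:
  assumes "bounded_clinear T"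
  shows "bounded_clinear (cadjoint T)"
proof -
  note adj = cadjoint_works[OF assms, symmetric]
  have scC: "cadjoint T (c *\<^sub>C y) = c *\<^sub>C cadjoint T y" for c y
    by (rule cinner_ext) (simp add: adj cinner_scaleC_right)
  interpret T: bounded_linear T
    using assms by (simp add: bounded_clinear_def)
  obtain K where K: "\<And>x. norm (T x) \<le> norm x * K"
    using T.bounded by blast
  have "norm (cadjoint T y) \<le> norm y * K" for y
  proof -
    let ?z = "cadjoint T y"
    have "norm ?z * norm ?z = Re (cinner (T ?z) y)"
      using power2_norm_eq_cinner[of ?z] by (simp add: adj power2_eq_square)
    also have "\<dots> \<le> norm (T ?z) * norm y" by (rule Re_cinner_le)
    also have "\<dots> \<le> norm ?z * K * norm y" by (intro mult_right_mono K) simp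
    finally have *: "norm ?z * norm ?z \<le> norm ?z * (norm y * K)" by (simp add: ac_simps)
    show ?thesis
    proof (cases "?z = 0")
      case True
      then show ?thesis
        using order_trans[OF norm_ge_zero K[of y]] by simp
    next
      case False
      then show ?thesis using * by simp
    qed
  qed
  moreover have "cadjoint T (x + y) = cadjoint T x + cadjoint T y" for x y
    by (rule cinner_ext) (simp add: adj cinner_add_right)
  ultimately have "bounded_linear (cadjoint T)"
    by (intro bounded_linear_intro[where K = K]) (auto simp: scC scaleR_eq_scaleC)
  then show ?thesis
    by (simp add: bounded_clinear_def scC)
qed

section \<open>Quasinormality\<close>

definition op_commutator :: "('a::complex_inner \<Rightarrow> 'a) \<Rightarrow> ('a \<Rightarrow> 'a) \<Rightarrow> 'a \<Rightarrow> 'a" where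
  "op_commutator S T = (\<lambda>x. (S \<circ> T) x - (T \<circ> S) x)"

definition op_kernel :: "('a::complex_inner \<Rightarrow> 'a) \<Rightarrow> 'a set" where
  "op_kernel T = {x. T x = 0}"

definition quasinormal :: "('a::chilbert_space \<Rightarrow> 'a) \<Rightarrow> bool" where
  "quasinormal T \<longleftrightarrow> op_commutator T (cadjoint T \<circ> T) = (\<lambda>_. 0)"

definition PQ :: "('a::chilbert_space \<Rightarrow> 'a) \<Rightarrow> nat set" where
  "PQ T = {n. 1 \<le> n \<and> op_commutator (T ^^ n) (cadjoint T \<circ> T) = (\<lambda>_. 0)}"

end

theory Submission
  imports Defs
begin

text \<open>
  Write \<open>A = T\<^sup>*T\<close> and \<open>C = TA - AT\<close>. The powers of \<open>T\<close> that commute with \<open>A\<close> are closed under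
  taking powers, so by Bezout two consecutive powers \<open>T\<^sup>n\<close> and \<open>T\<^sup>n\<^sup>+\<^sup>1\<close> commute with \<open>A\<close>, and then
  \<open>T\<^sup>n C = T\<^sup>n\<^sup>+\<^sup>1 A - T\<^sup>n A T = A T\<^sup>n\<^sup>+\<^sup>1 - A T\<^sup>n\<^sup>+\<^sup>1 = 0\<close>. The inclusion \<open>ker T \<subseteq> ker T\<^sup>*\<close> yields
  \<open>ker T\<^sup>2 = ker T\<close>, hence \<open>ker T\<^sup>n \<subseteq> ker T\<close>, so that every \<open>Cx\<close> lies in \<open>ker T\<close> and therefore in
  \<open>ker T\<^sup>*\<close> (for \<open>n = 0\<close>, trivially \<open>C = 0\<close>). Consequently \<open>Cx\<close> is orthogonal to the range of \<open>T\<^sup>*\<close>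
  and to the range of \<open>T\<close>. But \<open>Cx = T(Ax) - T\<^sup>*(T(Tx))\<close> is a difference of elements of these two
  ranges, so it is orthogonal to itself and vanishes.
\<close>

lemma cadjoint_works_left:
  assumes "bounded_clinear T"
  shows "cinner (cadjoint T x) y = cinner x (T y)"
  by (metis assms cadjoint_works cinner_commute)

lemma funpow_commute:
  assumes "\<And>x. f (g x) = g (f x)"
  shows "(f ^^ k) (g x) = g ((f ^^ k) x)"
  by (induction k) (simp_all add: assms)

lemma PQ_commute:
  assumes "n \<in> PQ T"
  shows "(T ^^ (n * k)) (cadjoint T (T x)) = cadjoint T (T ((T ^^ (n * k)) x))"
proof -
  have "(T ^^ n) (cadjoint T (T x)) = cadjoint T (T ((T ^^ n) x))" for x
    using assms by (simp add: PQ_def op_commutator_def fun_eq_iff)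
  then show ?thesis
    using funpow_commute[of "T ^^ n" "cadjoint T \<circ> T" k x] by (simp add: funpow_mult mult.commute)
qed

lemma kernel_square_eq_kernel:
  assumes T: "bounded_clinear T"
    and ker: "op_kernel T \<subseteq> op_kernel (cadjoint T)"
    and zero: "T (T x) = 0"
  shows "T x = 0"
proof -
  have "cadjoint T (T x) = 0"
    using ker zero by (auto simp: op_kernel_def)
  then have "cinner (T x) (T x) = cinner x 0"
    by (simp add: cadjoint_works[OF T])
  also have "\<dots> = 0"
    using cinner_diff_right[of x 0 0] by simp
  finally show ?thesis
    by (simp add: cinner_eq_zero_iff)
qed

lemma kernel_power_subset_kernel:
  assumes "bounded_clinear T" and "op_kernel T \<subseteq> op_kernel (cadjoint T)"
    and "(T ^^ Suc n) x = 0"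
  shows "T x = 0"
  using assms(3)
proof (induction n)
  case (Suc n)
  then show ?case
    using kernel_square_eq_kernel[OF assms(1,2), of "(T ^^ n) x"] by simp
qed simp

lemma diff_range_eq_zero:
  assumes T: "bounded_clinear T"
    and z: "z = T u - cadjoint T v"
    and ker: "T z = 0" "cadjoint T z = 0"
  shows "z = 0"
proof -
  have zero: "cinner (0::'a) w = 0" for w
    using cinner_add_left[of 0 0 w] by simp
  have "cinner z z = cinner z (T u) - cinner z (cadjoint T v)"
    by (subst (2) z) (rule cinner_diff_right)
  also have "\<dots> = cinner (cadjoint T z) u - cinner (T z) v"
    by (simp add: cadjoint_works[OF T] cadjoint_works_left[OF T])
  finally show ?thesis
    by (simp add: ker zero cinner_eq_zero_iff)
qed

lemma quasinormal_if_consecutive_powers_commute: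
  assumes T: "bounded_clinear T"
    and ker: "op_kernel T \<subseteq> op_kernel (cadjoint T)"
    and n: "\<And>x. (T ^^ n) (cadjoint T (T x)) = cadjoint T (T ((T ^^ n) x))"
    and Suc_n: "\<And>x. (T ^^ Suc n) (cadjoint T (T x)) = cadjoint T (T ((T ^^ Suc n) x))"
  shows "quasinormal T"
proof -
  interpret T: bounded_linear T
    using T by (simp add: bounded_clinear_def)
  have pow_diff: "(T ^^ k) (x - y) = (T ^^ k) x - (T ^^ k) y" for k x y
    by (induction k) (simp_all add: T.diff)
  have "T (cadjoint T (T x)) - cadjoint T (T (T x)) = 0" (is "?C = 0") for x
  proof -
    have C: "(T ^^ n) ?C = 0"
      using n[of "T x"] Suc_n[of x] by (simp add: pow_diff funpow_swap1)
    have "T ?C = 0"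
    proof (cases n)
      case 0
      then show ?thesis
        using C by (simp add: T.zero)
    next
      case (Suc m)
      then show ?thesis
        using kernel_power_subset_kernel[OF T ker] C by blast
    qed
    moreover from this have "cadjoint T ?C = 0"
      using ker by (auto simp: op_kernel_def)
    ultimately show ?thesis
      using diff_range_eq_zero[OF T] by blast
  qed
  then show ?thesis
    by (simp add: quasinormal_def op_commutator_def)
qed

theorem corollary3p7:
  fixes T :: "'a::chilbert_space \<Rightarrow> 'a" and s t :: nat
  assumes "bounded_clinear T"
    and "op_kernel T \<subseteq> op_kernel (cadjoint T)"
    and "s \<in> PQ T" and "t \<in> PQ T" and "coprime s t"
  shows "quasinormal T"
proof -
  have "s \<noteq> 0"
    using assms(3) by (auto simp: PQ_def)
  then obtain a b where "s * a = Suc (t * b)"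
    using bezout_nat[of s t] assms(5) by auto
  then show ?thesis
    using quasinormal_if_consecutive_powers_commute[OF assms(1,2), of "t * b"]
      PQ_commute[OF assms(3), of a] PQ_commute[OF assms(4), of b] by simp
qed

end
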